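(* For each integer $k \ge 7$, any complete $k$-partite graph is competitively orientable.
   Context: All graphs are finite and simple, and the partite sets of a complete $k$-partite graph are nonempty. An orientation of a graph $G$ is a digraph $D$ on the vertex set $V(G)$ with no loops, no multiple arcs and no directed $2$-cycles, whose underlying graph (with edge set $\{uv \mid (u,v)\in A(D)\}$) is $G$. A digraph $D$ is competitive if every pair of distinct vertices $x,y$ has a common out-neighbor, i.e. there is a vertex $z$ with $(x,z),(y,z)\in A(D)$. A graph is competitively orientable if it has a competitive orientation. *)

theory Defs
  imports "Graph_Theory.Digraph_Component" "HOL-Library.Disjoint_Sets"
begin

text \<open>
  As in \<^theory>\<open>Graph_Theory.Digraph\<close>, an undirected graph is a symmetric digraph; the finite simple
  graphs are those satisfying \<^const>\<open>pair_graph\<close>. Arcs are pairs of vertices, which rules out multiple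
  arcs.
\<close>

definition complete_multipartite :: "nat \<Rightarrow> 'a pair_pre_digraph \<Rightarrow> bool" where
  "complete_multipartite k G \<longleftrightarrow> pair_graph G \<and>
     (\<exists>P. partition_on (pverts G) P \<and> card P = k \<and>
          parcs G = {(u, v). \<exists>A \<in> P. \<exists>B \<in> P. A \<noteq> B \<and> u \<in> A \<and> v \<in> B})"

text \<open>\<^const>\<open>mk_symmetric\<close> keeps the vertex set and adds the reverse of every arc, so it yields the
  underlying graph of a digraph.\<close>

definition orientation :: "'a pair_pre_digraph \<Rightarrow> 'a pair_pre_digraph \<Rightarrow> bool" where
  "orientation D G \<longleftrightarrow> pair_digraph D \<and>
     (\<forall>u v. (u, v) \<in> parcs D \<longrightarrow> (v, u) \<notin> parcs D) \<and>
     mk_symmetric (with_proj D) = G"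

definition competitive :: "'a pair_pre_digraph \<Rightarrow> bool" where
  "competitive D \<longleftrightarrow>
     (\<forall>x \<in> pverts D. \<forall>y \<in> pverts D. x \<noteq> y \<longrightarrow>
        (\<exists>z \<in> pverts D. (x, z) \<in> parcs D \<and> (y, z) \<in> parcs D))"

definition competitively_orientable :: "'a pair_pre_digraph \<Rightarrow> bool" where
  "competitively_orientable G \<longleftrightarrow> (\<exists>D. orientation D G \<and> competitive D)"

end

theory Submission
  imports Defs
begin

text \<open>
  It suffices to orient the complete graph on the \<open>k\<close> parts: blowing up a competitive tournament
  keeps it competitive, since two vertices of one part have the same out-neighbours, and there is at
  least one. For \<open>k = 7\<close> the Paley tournament is competitive because the quadratic residues
  \<open>{1, 2, 4}\<close> form a difference set modulo 7. Every further vertex is made to beat all previous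
  ones; it then shares an out-neighbour among the seven Paley vertices with any other vertex.
\<close>

text \<open>Adding 7 before subtracting \<open>i\<close> avoids truncated subtraction on the
  naturals.\<close>

definition beats :: "nat \<Rightarrow> nat \<Rightarrow> bool" where
  "beats i j \<longleftrightarrow> (if i < 7 then j < 7 \<and> (j + 7 - i) mod 7 \<in> {1, 2, 4} else j < i)"

lemma less_7_cases:
  "(i::nat) < 7 \<Longrightarrow> i = 0 \<or> i = 1 \<or> i = 2 \<or> i = 3 \<or> i = 4 \<or> i = 5 \<or> i = 6"
  by linarith

lemma beats_irrefl: "\<not> beats i i"
  by (simp add: beats_def)

text \<open>Since -1 is not a square modulo 7, exactly one of \<open>d\<close> and \<open>-d\<close>
  lies in \<open>{1, 2, 4}\<close> for each nonzero residue \<open>d\<close>; labels from 7 on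
  follow the linear order. The same fact gives \<open>beats_total\<close>.\<close>

lemma beats_asym: "beats i j \<Longrightarrow> \<not> beats j i"
  using less_7_cases[of i] less_7_cases[of j]
  by (cases "i < 7"; cases "j < 7") (auto simp: beats_def)

lemma beats_total: "i \<noteq> j \<Longrightarrow> beats i j \<or> beats j i"
  using less_7_cases[of i] less_7_cases[of j]
  by (cases "i < 7"; cases "j < 7") (auto simp: beats_def)

lemma ex_less_7: "(\<exists>l<7. P l) \<longleftrightarrow> P 0 \<or> P 1 \<or> P 2 \<or> P 3 \<or> P 4 \<or> P 5 \<or> P (6::nat)"
  by (simp add: eval_nat_numeral Ex_less_Suc disj_ac)

text \<open>Equal labels are included to serve two vertices of one part. The bound on
  \<open>l\<close> keeps the common out-neighbour among the seven Paley labels.\<close>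

lemma beats_common: "\<exists>l<7. beats i l \<and> beats j l"
proof -
  have paley: "\<exists>l<7. beats i l \<and> beats j l" if "i < 7" "j < 7" for i j
    using less_7_cases[OF that(1)] less_7_cases[OF that(2)]
    unfolding ex_less_7 by (elim disjE) (simp_all add: beats_def)
  have top: "beats i l" if "\<not> i < 7" "l < 7" for i l
    using that by (simp add: beats_def)
  show ?thesis
  proof (cases "i < 7"; cases "j < 7")
    assume "\<not> i < 7" "\<not> j < 7"
    then show ?thesis using top[of _ 0] by (intro exI[of _ 0]) simp
  \<comment> \<open>When just one index is at least 7, it beats every Paley label, so any
    out-neighbour of the other index is shared; \<open>paley\<close> with equal arguments supplies
    one.\<close>
  qed (use paley[of i i] paley[of j j] paley[of i j] top in blast)+
qed

text \<open>Numbering the parts lets a tournament on labels be pulled back to the vertices. Parts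
  are nonempty, so every label below \<open>k\<close> occurs.\<close>

lemma complete_multipartite_labelling:
  assumes "complete_multipartite k G" "k > 0"
  obtains h :: "'a \<Rightarrow> nat"
  where "h ` pverts G = {..<k}"
    and "parcs G = {(u, v). u \<in> pverts G \<and> v \<in> pverts G \<and> h u \<noteq> h v}"
proof -
  obtain P where P: "partition_on (pverts G) P" "card P = k"
    and arcs: "parcs G = {(u, v). \<exists>A \<in> P. \<exists>B \<in> P. A \<noteq> B \<and> u \<in> A \<and> v \<in> B}"
    using assms(1) by (auto simp: complete_multipartite_def)
  \<comment> \<open>Infinite sets have \<open>card\<close> 0, so a positive \<open>card P\<close>
    gives finiteness.\<close>
  have "finite P" using P(2) assms(2) card_ge_0_finite by blast
  then obtain f where f: "bij_betw f P {..<k}"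
    using P(2) ex_bij_betw_finite_nat[of P] by (auto simp: atLeast0LessThan)
  define part where "part u = (THE A. A \<in> P \<and> u \<in> A)" for u
  have part_eq: "part u = A" if "A \<in> P" "u \<in> A" for u A
    unfolding part_def using that partition_onD2[OF P(1)]
    by (intro the_equality) (auto simp: disjoint_def)
  have V: "u \<in> pverts G \<longleftrightarrow> (\<exists>A\<in>P. u \<in> A)" for u
    using partition_onD1[OF P(1)] by auto
  have ne: "A \<noteq> {}" if "A \<in> P" for A
    using partition_onD3[OF P(1)] that by auto
  have "part ` pverts G = P"
  proof (intro equalityI subsetI)
    fix A assume "A \<in> part ` pverts G"
    then show "A \<in> P" using V part_eq by auto
  next
    fix A assume "A \<in> P"
    moreover obtain u where "u \<in> A" using ne[OF \<open>A \<in> P\<close>] by blast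
    ultimately show "A \<in> part ` pverts G"
      using V part_eq by (intro image_eqI[of _ _ u]) auto
  qed
  then have "(f \<circ> part) ` pverts G = {..<k}"
    using f by (metis bij_betw_def image_comp)
  moreover have "parcs G =
      {(u, v). u \<in> pverts G \<and> v \<in> pverts G \<and> (f \<circ> part) u \<noteq> (f \<circ> part) v}"
    unfolding arcs using V part_eq inj_on_eq_iff[OF bij_betw_imp_inj_on[OF f]]
    by auto metis+
  ultimately show ?thesis by (rule that)
qed

theorem proposition3p1:
  fixes k :: nat and G :: "'a pair_pre_digraph"
  assumes "k \<ge> 7" and "complete_multipartite k G"
  shows "competitively_orientable G"
proof -
  obtain h :: "'a \<Rightarrow> nat" where h: "h ` pverts G = {..<k}"
    and arcs: "parcs G = {(u, v). u \<in> pverts G \<and> v \<in> pverts G \<and> h u \<noteq> h v}"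
    using complete_multipartite_labelling[OF assms(2)] assms(1) by auto
  interpret pair_graph G
    using assms(2) by (simp add: complete_multipartite_def)
  \<comment> \<open>The blow-up of the tournament \<open>beats\<close> along
    \<open>h\<close>.\<close>
  define D where "D = \<lparr>pverts = pverts G,
    parcs = {(u, v). u \<in> pverts G \<and> v \<in> pverts G \<and> beats (h u) (h v)}\<rparr>"
  have "pair_digraph D"
  proof
    show "finite (parcs D)"
      by (rule finite_subset[of _ "pverts G \<times> pverts G"]) (auto simp: D_def)
  qed (auto simp: D_def beats_irrefl)
  moreover have "mk_symmetric (with_proj D) = G"
  proof (rule pair_pre_digraph.equality)
    show "parcs (mk_symmetric (with_proj D)) = parcs G"
      unfolding arcs using beats_total beats_irrefl
      by (auto simp: D_def parcs_mk_symmetric) metis+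
  qed (simp_all add: D_def mk_symmetric_def)
  ultimately have "orientation D G"
    using beats_asym by (auto simp: orientation_def D_def)
  moreover have "competitive D"
    unfolding competitive_def
  proof (intro ballI impI)
    fix x y assume xy: "x \<in> pverts D" "y \<in> pverts D"
    obtain l where l: "l < 7" "beats (h x) l" "beats (h y) l"
      using beats_common by blast
    \<comment> \<open>Here \<open>k \<ge> 7\<close> enters: all seven Paley labels belong to actual
      parts.\<close>
    have "l \<in> h ` pverts G"
      using l(1) assms(1) h by simp
    then obtain z where "z \<in> pverts G" "h z = l" by auto
    then show "\<exists>z \<in> pverts D. (x, z) \<in> parcs D \<and> (y, z) \<in> parcs D"
      using xy l by (intro bexI[of _ z]) (auto simp: D_def)
  qed
  ultimately show ?thesis
    by (auto simp: competitively_orientable_def)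
qed

end
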